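(* Let $m\ge 3$ be an odd integer, let $C_m$ be the cycle on $m$ vertices, and let $C_m[2K_1]$ be its composition with the empty graph on $2$ vertices. Then $D(C_m[2K_1],2)=2$.
   Context: Graphs are finite and simple. For a graph $G$ and a positive integer $k$, a (fractional) $k$-coloring of $G$ is an assignment to every vertex $v$ of real numbers $f_1(v),\dots,f_k(v)\ge 0$ with $\sum_{j=1}^k f_j(v)=1$ ($f_j(v)$ is the usage of color $j$ at $v$). The defect of $v$ is $\mathrm{df}(v)=\sum_{w\in N(v)}\sum_{j=1}^k\min(f_j(v),f_j(w))$, where $N(v)$ is the set of neighbors of $v$. The defect of the coloring is $\max_v \mathrm{df}(v)$, and the minimum defect $D(G,k)$ is the minimum of this quantity over all $k$-colorings of $G$. For a graph $G$ and a positive integer $a$, the composition $G[aK_1]$ is the graph obtained by replacing every vertex $v$ of $G$ by an independent set $I_v$ of size $a$, where a vertex of $I_v$ is adjacent to a vertex of $I_w$ if and only if $v$ and $w$ are adjacent in $G$. *)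

theory Defs
  imports Complex_Main "Graph_Theory.Pair_Digraph"
begin

text \<open>
  Finite simple graphs are the \<open>pair_graph\<close>s of the library: an undirected edge is a pair of
  opposite arcs, so the neighbours of \<open>v\<close> are the heads of the arcs leaving \<open>v\<close>.
\<close>

definition nbrs :: "'a pair_pre_digraph \<Rightarrow> 'a \<Rightarrow> 'a set" where
  "nbrs G v = {w. (v, w) \<in> parcs G}"

definition is_coloring :: "'a pair_pre_digraph \<Rightarrow> nat \<Rightarrow> ('a \<Rightarrow> nat \<Rightarrow> real) \<Rightarrow> bool" where
  "is_coloring G k f \<longleftrightarrow>
     (\<forall>v\<in>pverts G. (\<forall>j\<in>{1..k}. 0 \<le> f v j) \<and> (\<Sum>j=1..k. f v j) = 1)"

definition vertex_defect :: "'a pair_pre_digraph \<Rightarrow> nat \<Rightarrow> ('a \<Rightarrow> nat \<Rightarrow> real) \<Rightarrow> 'a \<Rightarrow> real" where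
  "vertex_defect G k f v = (\<Sum>w\<in>nbrs G v. \<Sum>j=1..k. min (f v j) (f w j))"

definition coloring_defect :: "'a pair_pre_digraph \<Rightarrow> nat \<Rightarrow> ('a \<Rightarrow> nat \<Rightarrow> real) \<Rightarrow> real" where
  "coloring_defect G k f = Max (vertex_defect G k f ` pverts G)"

text \<open>
  A genuine minimum, not an infimum: evaluating the \<open>LEAST\<close> requires a coloring that attains
  the value. For a nonempty finite graph and \<open>k \<ge> 1\<close> one exists by compactness.
\<close>

definition min_defect :: "'a pair_pre_digraph \<Rightarrow> nat \<Rightarrow> real" where
  "min_defect G k = (LEAST d. \<exists>f. is_coloring G k f \<and> d = coloring_defect G k f)"

text \<open>The arcs below form a simple cycle only for \<open>m \<ge> 3\<close>.\<close>

definition cycle_graph :: "nat \<Rightarrow> nat pair_pre_digraph" where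
  "cycle_graph m =
     \<lparr> pverts = {..<m},
       parcs = {(i, j). i < m \<and> j < m \<and> (j = Suc i mod m \<or> i = Suc j mod m)} \<rparr>"

text \<open>\<open>blow_up G a\<close> is the composition \<open>G[aK\<^sub>1]\<close>, with \<open>I\<^sub>v = {v} \<times> {..<a}\<close>.\<close>

definition blow_up :: "'a pair_pre_digraph \<Rightarrow> nat \<Rightarrow> ('a \<times> nat) pair_pre_digraph" where
  "blow_up G a =
     \<lparr> pverts = pverts G \<times> {..<a},
       parcs = {((v, i), (w, j)) | v i w j. (v, w) \<in> parcs G \<and> i < a \<and> j < a} \<rparr>"

lemma pair_graph_cycle_graph:
  assumes "m \<ge> 3"
  shows "pair_graph (cycle_graph m)"
proof
  show "finite (parcs (cycle_graph m))"
    by (rule finite_subset[of _ "{..<m} \<times> {..<m}"]) (auto simp: cycle_graph_def)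
  fix e assume "e \<in> parcs (cycle_graph m)"
  then show "fst e \<noteq> snd e"
    using assms by (cases "Suc (fst e) = m") (auto simp: cycle_graph_def mod_Suc)
qed (auto simp: cycle_graph_def symmetric_def sym_def)

lemma pair_graph_blow_up:
  assumes "pair_graph G"
  shows "pair_graph (blow_up G a)"
proof -
  interpret pair_graph G by fact
  show ?thesis
  proof
    show "finite (parcs (blow_up G a))"
      by (rule finite_subset[of _ "(pverts G \<times> {..<a}) \<times> (pverts G \<times> {..<a})"])
        (auto simp: blow_up_def dest: in_arcsD1 in_arcsD2)
    show "symmetric (blow_up G a)"
      using arcs_symmetric by (auto simp: blow_up_def symmetric_def sym_def)
  qed (auto simp: blow_up_def dest: in_arcsD1 in_arcsD2 no_loops')
qed

end

theory Submission
  imports Defs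
begin

text \<open>
  A 2-coloring amounts to one number \<open>x\<^sub>v \<in> [0,1]\<close> per vertex, the usage of color 1, and an edge
  \<open>vw\<close> costs \<open>min x\<^sub>v x\<^sub>w + min (1 - x\<^sub>v) (1 - x\<^sub>w) = 1 - \<bar>x\<^sub>v - x\<^sub>w\<bar>\<close>. In \<open>C\<^sub>m[2K\<^sub>1]\<close> every vertex
  has four neighbors, so its defect is below 2 exactly when its distances to the neighboring
  values add up to more than 2. Giving the two copies of every vertex of the cycle different
  colors makes every defect equal to 2.

  For the lower bound, suppose that all these sums of distances exceed 2. No value is
  \<open>1/2\<close>, as distances to \<open>1/2\<close> are at most \<open>1/2\<close>. So every vertex is low (value below \<open>1/2\<close>) or
  high, and low and high are exchanged by swapping the colors. A low vertex has at most one
  neighbor whose value does not exceed its own: two such neighbors contribute at most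
  \<open>x\<close> each and the other two at most \<open>1 - x\<close> each (lemma \<open>sum_dist_le_two_if_low\<close>).
  This has two consequences for the cycle.

  \<^item> The two copies of a vertex are both low or both high. If their values were
    \<open>x < 1/2 < x'\<close>, then at most one of their four common neighbors would lie below \<open>x\<close> and at most one
    above \<open>x'\<close>, and the two sums of distances would add up to at most 4 (lemma \<open>twins_same_side\<close>).
  \<^item> Consecutive vertices of the cycle have copies of opposite kinds. Otherwise four
    vertices forming a 4-cycle would all be low, say, and the largest of their values would have two
    neighbors not exceeding it (lemma \<open>adjacent_pairs_opposite_sides\<close>).

  Hence low and high alternate around the cycle, which is impossible for odd \<open>m\<close>.
\<close>

section \<open>Sums of distances in the unit interval\<close>

lemma sum_dist_le_two_if_low:
  fixes x y z u w :: real
  assumes "x \<le> 1/2" "y \<le> x" "z \<le> x" "0 \<le> y" "0 \<le> z" "u \<in> {0..1}" "w \<in> {0..1}"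
  shows "\<bar>x - y\<bar> + \<bar>x - z\<bar> + \<bar>x - u\<bar> + \<bar>x - w\<bar> \<le> 2"
proof -
  have "\<bar>x - u\<bar> \<le> 1 - x" "\<bar>x - w\<bar> \<le> 1 - x"
    using assms by (auto simp: abs_le_iff)
  then show ?thesis using assms by linarith
qed

text \<open>This says that a vertex of value \<open>x\<close> with neighbors of values \<open>p, q, r, s\<close> has defect below 2.\<close>

definition far :: "real \<Rightarrow> real \<Rightarrow> real \<Rightarrow> real \<Rightarrow> real \<Rightarrow> bool" where
  "far x p q r s \<longleftrightarrow> \<bar>x - p\<bar> + \<bar>x - q\<bar> + \<bar>x - r\<bar> + \<bar>x - s\<bar> > 2"

text \<open>Swapping the two colors exchanges \<open>x\<close> and \<open>1 - x\<close>; it reduces high vertices to low ones.\<close>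

lemma far_swap_colors: "far (1 - x) (1 - p) (1 - q) (1 - r) (1 - s) \<longleftrightarrow> far x p q r s"
  by (simp add: far_def abs_minus_commute)

lemma far_not_half:
  assumes "far x p q r s" "{p, q, r, s} \<subseteq> {0..1}"
  shows "x \<noteq> 1/2"
proof
  assume x: "x = 1/2"
  have "\<bar>x - y\<bar> \<le> 1/2" if "y \<in> {p, q, r, s}" for y
  proof -
    have "0 \<le> y" "y \<le> 1" using that assms(2) by auto
    then show ?thesis using x by linarith
  qed
  from this[of p] this[of q] this[of r] this[of s] show False
    using assms(1) by (simp add: far_def)
qed

lemma far_low_at_most_one_below:
  assumes "far x p q r s" "x < 1/2" "{p, q, r, s} \<subseteq> {0..1}"
  shows "(p \<le> x \<longrightarrow> x < q \<and> x < r \<and> x < s) \<and> (q \<le> x \<longrightarrow> x < r \<and> x < s) \<and> (r \<le> x \<longrightarrow> x < s)"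
proof -
  have *: "\<bar>x - y\<bar> + \<bar>x - z\<bar> + \<bar>x - u\<bar> + \<bar>x - w\<bar> \<le> 2"
    if "{y, z, u, w} \<subseteq> {p, q, r, s}" "y \<le> x" "z \<le> x" for y z u w
    using that assms by (intro sum_dist_le_two_if_low) auto
  have "\<not> (p \<le> x \<and> q \<le> x)" "\<not> (p \<le> x \<and> r \<le> x)" "\<not> (p \<le> x \<and> s \<le> x)"
    "\<not> (q \<le> x \<and> r \<le> x)" "\<not> (q \<le> x \<and> s \<le> x)" "\<not> (r \<le> x \<and> s \<le> x)"
    using *[of p q r s] *[of p r q s] *[of p s q r] *[of q r p s] *[of q s p r] *[of r s p q]
      assms(1) unfolding far_def by (force simp: algebra_simps)+
  then show ?thesis unfolding not_le[symmetric] by blast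
qed

lemma far_high_at_most_one_above:
  assumes "far x p q r s" "1/2 < x" "{p, q, r, s} \<subseteq> {0..1}"
  shows "(x \<le> p \<longrightarrow> q < x \<and> r < x \<and> s < x) \<and> (x \<le> q \<longrightarrow> r < x \<and> s < x) \<and> (x \<le> r \<longrightarrow> s < x)"
  using far_low_at_most_one_below[of "1 - x" "1 - p" "1 - q" "1 - r" "1 - s"] assms
  by (auto simp: far_swap_colors)

text \<open>
  For \<open>x \<le> x'\<close> the distances of \<open>y\<close> to \<open>x\<close> and \<open>x'\<close> add up to \<open>x' - x\<close> plus twice the distance from
  \<open>y\<close> to the interval \<open>[x, x']\<close>. When at most one of four points lies to the left of the interval
  and at most one to its right, those excess terms total at most \<open>2x + 2(1 - x')\<close>, so the whole
  sum is at most \<open>2 + 2(x' - x) \<le> 4\<close>.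
\<close>

lemma twins_same_side:
  assumes far: "far x p q r s" "far x' p q r s"
    and unit: "{x, x', p, q, r, s} \<subseteq> {0..1}"
    and low: "x < 1/2"
  shows "x' < 1/2"
proof (rule ccontr)
  assume "\<not> x' < 1/2"
  moreover have "x' \<noteq> 1/2" using far_not_half[OF far(2)] unit by simp
  ultimately have high: "1/2 < x'" by simp
  define below where "below y = max 0 (x - y)" for y
  define above where "above y = max 0 (y - x')" for y
  have split: "\<bar>x - y\<bar> + \<bar>x' - y\<bar> = (x' - x) + 2 * below y + 2 * above y" for y
    using low high by (auto simp: below_def above_def max_def abs_if)
  have "below y = 0" if "x < y" for y using that by (simp add: below_def)
  moreover have "below p \<le> x" "below q \<le> x" "below r \<le> x" "below s \<le> x"
    using unit by (simp_all add: below_def)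
  ultimately have "below p + below q + below r + below s \<le> x"
    using far_low_at_most_one_below[OF far(1) low] unit
    by (cases "p \<le> x"; cases "q \<le> x"; cases "r \<le> x") (simp_all add: not_le)
  moreover have "above p + above q + above r + above s \<le> 1 - x'"
  proof -
    have "above y = 0" if "y < x'" for y using that by (simp add: above_def)
    moreover have "above p \<le> 1 - x'" "above q \<le> 1 - x'" "above r \<le> 1 - x'" "above s \<le> 1 - x'"
      using unit by (simp_all add: above_def)
    ultimately show ?thesis
      using far_high_at_most_one_above[OF far(2) high] unit
      by (cases "x' \<le> p"; cases "x' \<le> q"; cases "x' \<le> r") (simp_all add: not_le)
  qed
  moreover have "x' - x \<le> 1" using unit by auto
  ultimately show False
    using far split[of p] split[of q] split[of r] split[of s]
    unfolding far_def by linarith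
qed

text \<open>
  Here \<open>a, b\<close> and \<open>c, d\<close> are the values of the copies of two consecutive cycle vertices, and \<open>p, q\<close>
  and \<open>r, s\<close> those of the vertex before and the vertex after them.
\<close>

lemma adjacent_pairs_not_both_low:
  assumes far: "far a c d p q" "far b c d p q" "far c r s a b" "far d r s a b"
    and unit: "{a, b, c, d, p, q, r, s} \<subseteq> {0..1}"
    and low: "a < 1/2" "b < 1/2" "c < 1/2" "d < 1/2"
  shows False
proof -
  \<comment> \<open>The value \<open>a\<close> (and likewise each of the others) is exceeded by one of the two neighboring values
    among the four.\<close>
  have exceeded: "(x < y \<or> x < z) \<and> (x < u \<or> x < w)"
    if "far x y z u w" "x < 1/2" "{y, z, u, w} \<subseteq> {0..1}" for x y z u w
    using far_low_at_most_one_below[OF that] by linarith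
  have "a < c \<or> a < d" "b < c \<or> b < d" "c < a \<or> c < b" "d < a \<or> d < b"
    using exceeded[OF far(1) low(1)] exceeded[OF far(2) low(2)]
      exceeded[OF far(3) low(3)] exceeded[OF far(4) low(4)] unit by simp_all
  then show False by linarith
qed

lemma adjacent_pairs_opposite_sides:
  assumes far: "far a c d p q" "far b c d p q" "far c r s a b" "far d r s a b"
    and unit: "{a, b, c, d, p, q, r, s} \<subseteq> {0..1}"
  shows "c < 1/2 \<longleftrightarrow> \<not> a < 1/2"
proof -
  have twins: "a < 1/2 \<longleftrightarrow> b < 1/2" "c < 1/2 \<longleftrightarrow> d < 1/2"
    using twins_same_side[OF far(1,2)] twins_same_side[OF far(2,1)]
      twins_same_side[OF far(3,4)] twins_same_side[OF far(4,3)] unit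
    unfolding insert_subset by blast+
  have "\<not> (a < 1/2 \<and> c < 1/2)"
    using adjacent_pairs_not_both_low[OF far unit] twins by blast
  moreover have "\<not> (1/2 < a \<and> 1/2 < b \<and> 1/2 < c \<and> 1/2 < d)"
    using adjacent_pairs_not_both_low[of "1 - a" "1 - c" "1 - d" "1 - p" "1 - q" "1 - b" "1 - r" "1 - s",
        unfolded far_swap_colors, OF far] unit by auto
  moreover have "a \<noteq> 1/2" "b \<noteq> 1/2" "c \<noteq> 1/2" "d \<noteq> 1/2"
    using far_not_half[OF far(1)] far_not_half[OF far(2)]
      far_not_half[OF far(3)] far_not_half[OF far(4)] unit by simp_all
  ultimately show ?thesis using twins by linarith
qed

section \<open>Defects in the doubled cycle\<close>

lemma coloring_two_bounds:
  assumes "is_coloring G 2 f" "v \<in> pverts G"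
  shows "f v 1 \<in> {0..1}" "f v 2 = 1 - f v 1"
proof -
  have "{1..2::nat} = {1, 2}" by auto
  then have "0 \<le> f v 1" "0 \<le> f v 2" "f v 1 + f v 2 = 1"
    using assms by (auto simp: is_coloring_def)
  then show "f v 1 \<in> {0..1}" "f v 2 = 1 - f v 1" by auto
qed

lemma vertex_defect_two_colors:
  assumes "is_coloring G 2 f" "v \<in> pverts G" "nbrs G v \<subseteq> pverts G"
  shows "vertex_defect G 2 f v = (\<Sum>w\<in>nbrs G v. 1 - \<bar>f v 1 - f w 1\<bar>)"
  unfolding vertex_defect_def
proof (rule sum.cong[OF refl])
  fix w assume "w \<in> nbrs G v"
  then have "f w 2 = 1 - f w 1"
    using assms by (intro coloring_two_bounds) auto
  moreover have "f v 2 = 1 - f v 1"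
    using assms by (intro coloring_two_bounds)
  moreover have "{1..2::nat} = {1, 2}" by auto
  ultimately show "(\<Sum>j = 1..2. min (f v j) (f w j)) = 1 - \<bar>f v 1 - f w 1\<bar>"
    by (simp add: min_def abs_if)
qed

definition cyc_suc :: "nat \<Rightarrow> nat \<Rightarrow> nat" where
  "cyc_suc m i = Suc i mod m"

definition cyc_pred :: "nat \<Rightarrow> nat \<Rightarrow> nat" where
  "cyc_pred m i = (if i = 0 then m - 1 else i - 1)"

lemma cyc_simps:
  assumes "m \<ge> 3" "i < m"
  shows "cyc_suc m i < m" "cyc_pred m i < m" "cyc_suc m i \<noteq> cyc_pred m i"
    "cyc_pred m (cyc_suc m i) = i"
  using assms by (auto simp: cyc_suc_def cyc_pred_def mod_Suc)

lemma pverts_doubled_cycle: "pverts (blow_up (cycle_graph m) 2) = {..<m} \<times> {..<2}"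
  by (simp add: blow_up_def cycle_graph_def)

lemma nbrs_doubled_cycle:
  assumes "m \<ge> 3" "i < m" "a < 2"
  shows "nbrs (blow_up (cycle_graph m) 2) (i, a) = {cyc_suc m i, cyc_pred m i} \<times> {0, 1}"
proof -
  have "j < m \<and> (j = Suc i mod m \<or> i = Suc j mod m) \<longleftrightarrow> j \<in> {cyc_suc m i, cyc_pred m i}" for j
    using assms(1,2) by (auto simp: cyc_suc_def cyc_pred_def mod_Suc split: if_splits)
  moreover have "{0, 1} = {..<2::nat}" by auto
  ultimately show ?thesis
    using assms(2,3) by (auto simp: nbrs_def blow_up_def cycle_graph_def)
qed

lemma vertex_defect_doubled_cycle:
  assumes "m \<ge> 3" "i < m" "a < 2" "is_coloring (blow_up (cycle_graph m) 2) 2 f"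
  shows "vertex_defect (blow_up (cycle_graph m) 2) 2 f (i, a) =
    4 - (\<bar>f (i, a) 1 - f (cyc_suc m i, 0) 1\<bar> + \<bar>f (i, a) 1 - f (cyc_suc m i, 1) 1\<bar>
       + \<bar>f (i, a) 1 - f (cyc_pred m i, 0) 1\<bar> + \<bar>f (i, a) 1 - f (cyc_pred m i, 1) 1\<bar>)"
proof -
  have "nbrs (blow_up (cycle_graph m) 2) (i, a) \<subseteq> pverts (blow_up (cycle_graph m) 2)"
    using assms(1-3) by (auto simp: nbrs_doubled_cycle pverts_doubled_cycle cyc_simps)
  then have "vertex_defect (blow_up (cycle_graph m) 2) 2 f (i, a) =
      (\<Sum>w\<in>{cyc_suc m i, cyc_pred m i} \<times> {0, 1}. 1 - \<bar>f (i, a) 1 - f w 1\<bar>)"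
    using assms by (simp add: vertex_defect_two_colors pverts_doubled_cycle nbrs_doubled_cycle)
  also have "\<dots> = (\<Sum>j\<in>{cyc_suc m i, cyc_pred m i}. \<Sum>b\<in>{0, 1}. 1 - \<bar>f (i, a) 1 - f (j, b) 1\<bar>)"
    by (simp only: sum.cartesian_product case_prod_unfold prod.collapse)
  finally show ?thesis using cyc_simps(3)[OF assms(1,2)] by simp
qed

lemma no_alternation_on_odd_cycle:
  assumes "odd m" and alt: "\<And>i. i < m \<Longrightarrow> P (cyc_suc m i) \<longleftrightarrow> \<not> P i"
  shows False
proof -
  have P: "P i \<longleftrightarrow> (P 0 \<longleftrightarrow> even i)" if "i < m" for i
    using that
  proof (induction i)
    case (Suc i)
    then show ?case using alt[of i] by (auto simp: cyc_suc_def)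
  qed simp
  from assms(1) have "m - 1 < m" "Suc (m - 1) = m" "even (m - 1)"
    by (auto elim: oddE)
  then show False using P[of "m - 1"] alt[of "m - 1"] by (simp add: cyc_suc_def)
qed

section \<open>The minimum defect\<close>

lemma doubled_odd_cycle_defect_ge_two:
  assumes "m \<ge> 3" "odd m" and col: "is_coloring (blow_up (cycle_graph m) 2) 2 f"
  shows "2 \<le> coloring_defect (blow_up (cycle_graph m) 2) 2 f"
proof (rule ccontr)
  let ?G = "blow_up (cycle_graph m) 2"
  assume less: "\<not> 2 \<le> coloring_defect ?G 2 f"
  define x where "x i a = f (i, a) 1" for i a
  have far: "far (x i a) (x (cyc_suc m i) 0) (x (cyc_suc m i) 1)
      (x (cyc_pred m i) 0) (x (cyc_pred m i) 1)" if "i < m" "a < 2" for i a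
  proof -
    have "vertex_defect ?G 2 f (i, a) \<le> coloring_defect ?G 2 f"
      unfolding coloring_defect_def using that
      by (intro Max_ge) (auto simp: pverts_doubled_cycle)
    then show ?thesis
      using less vertex_defect_doubled_cycle[OF assms(1) that col] by (simp add: far_def x_def)
  qed
  have unit: "x i a \<in> {0..1}" if "i < m" "a < 2" for i a
    unfolding x_def using that
    by (intro coloring_two_bounds[OF col]) (auto simp: pverts_doubled_cycle)
  have "x (cyc_suc m i) 0 < 1/2 \<longleftrightarrow> \<not> x i 0 < 1/2" if i: "i < m" for i
  proof -
    note cyc = cyc_simps[OF assms(1)]
    let ?j = "cyc_suc m i"
    have j: "?j < m" using cyc i by blast
    show ?thesis
    proof (rule adjacent_pairs_opposite_sides)
      show "far (x i 0) (x ?j 0) (x ?j 1) (x (cyc_pred m i) 0) (x (cyc_pred m i) 1)"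
        "far (x i 1) (x ?j 0) (x ?j 1) (x (cyc_pred m i) 0) (x (cyc_pred m i) 1)"
        using far[OF i] by simp_all
      show "far (x ?j 0) (x (cyc_suc m ?j) 0) (x (cyc_suc m ?j) 1) (x i 0) (x i 1)"
        "far (x ?j 1) (x (cyc_suc m ?j) 0) (x (cyc_suc m ?j) 1) (x i 0) (x i 1)"
        using far[OF j] cyc(4)[OF i] by simp_all
      show "{x i 0, x i 1, x ?j 0, x ?j 1, x (cyc_pred m i) 0, x (cyc_pred m i) 1,
          x (cyc_suc m ?j) 0, x (cyc_suc m ?j) 1} \<subseteq> {0..1}"
        using unit[OF i] unit[OF j] unit[OF cyc(2)[OF i]] unit[OF cyc(1)[OF j]] by simp
    qed
  qed
  then show False by (rule no_alternation_on_odd_cycle[OF assms(2)])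
qed

lemma doubled_cycle_defect_two_coloring:
  assumes "m \<ge> 3"
  shows "\<exists>f. is_coloring (blow_up (cycle_graph m) 2) 2 f
    \<and> 2 = coloring_defect (blow_up (cycle_graph m) 2) 2 f"
proof -
  let ?G = "blow_up (cycle_graph m) 2"
  \<comment> \<open>Copies are numbered from 0, colors from 1.\<close>
  define f :: "nat \<times> nat \<Rightarrow> nat \<Rightarrow> real" where "f v j = (if j = Suc (snd v) then 1 else 0)" for v j
  have col: "is_coloring ?G 2 f"
    by (auto simp: is_coloring_def pverts_doubled_cycle f_def)
  have "vertex_defect ?G 2 f v = 2" if "v \<in> pverts ?G" for v
  proof -
    obtain i a where v: "v = (i, a)" "i < m" "a < 2"
      using \<open>v \<in> pverts ?G\<close> by (auto simp: pverts_doubled_cycle)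
    then have "a = 0 \<or> a = 1" by auto
    then show ?thesis
      using vertex_defect_doubled_cycle[OF assms v(2,3) col] v(1) by (auto simp: f_def)
  qed
  moreover have "(0, 0) \<in> pverts ?G" using assms by (simp add: pverts_doubled_cycle)
  ultimately have "vertex_defect ?G 2 f ` pverts ?G = {2}"
    by (auto simp: image_iff intro!: bexI[of _ "(0, 0)"])
  then show ?thesis using col by (auto simp: coloring_defect_def)
qed

theorem proposition8:
  fixes m :: nat
  assumes "m \<ge> 3" and "odd m"
  shows "min_defect (blow_up (cycle_graph m) 2) 2 = 2"
  unfolding min_defect_def
proof (rule Least_equality)
  show "\<exists>f. is_coloring (blow_up (cycle_graph m) 2) 2 f
      \<and> 2 = coloring_defect (blow_up (cycle_graph m) 2) 2 f"
    using assms(1) by (rule doubled_cycle_defect_two_coloring)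
qed (use doubled_odd_cycle_defect_ge_two[OF assms] in blast)

end
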